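(* Let $Q\in\mathbb{R}^{n\times n}$ be a symmetric matrix, $A\in\mathbb{R}^{m\times n}$, $q\in\mathbb{R}^n$, $b\in\mathbb{R}^m$, let $f(x)=\frac12 x^\top Qx+q^\top x$, and assume that $C=\{x\in\mathbb{R}^n\mid Ax\ge b\}$ is nonempty. Let $\eta,\rho>0$ and assume that $f$ is bounded below on $C$. Suppose that $x^*$ is a solution (global minimizer) of $\min\{f(x)\mid x\in C\}$ and that $x(\cdot)$ is the unique solution on $[0,+\infty)$ of $$\dot x(t)=\frac1\eta\Big[P_C\Big(x(t)-\frac1\rho\big(Qx(t)+q\big)\Big)-x(t)\Big]\quad (t\ge 0),\qquad x(0)=x^0,$$ for some $x^0\in C$. Then for every $t\ge 0$, $$\|x(t)-x^*\|\le \exp\Big(\frac{\alpha}{\eta}t\Big)\|x^0-x^*\|,$$ where $$\alpha:=\max_{\lambda\in\sigma(Q)}\Big[\frac{\lambda}{\rho}\Big(\frac{\lambda}{4\rho}-1\Big)\Big].$$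
   Context: $\mathbb{R}^n$ carries the Euclidean scalar product and norm. Inequalities between vectors are componentwise. $\sigma(Q)$ denotes the set of eigenvalues of $Q$. $P_C$ is the metric projection onto the closed convex set $C$, i.e. $P_C(x)$ is the unique $y\in C$ with $\|y-x\|=\inf_{z\in C}\|z-x\|$. It is known that for every $x^0\in\mathbb{R}^n$, $\rho>0$, $\eta>0$ the initial value problem $\dot x(t)=\frac1\eta\big[P_C\big(x(t)-\frac1\rho(Qx(t)+q)\big)-x(t)\big]$ $(t\ge 0)$, $x(0)=x^0$, has a unique $C^1$ solution $x:[0,+\infty)\to\mathbb{R}^n$. *)

theory Defs
  imports "HOL-Analysis.Analysis"
begin

definition quad_objective :: "real^'n^'n \<Rightarrow> real^'n \<Rightarrow> real^'n \<Rightarrow> real" where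
  "quad_objective Q q x = (1/2) * (x \<bullet> (Q *v x)) + q \<bullet> x"

(* The order on vectors is the componentwise one (less_eq_vec_def). *)
definition feasible_set :: "real^'n^'m \<Rightarrow> real^'m \<Rightarrow> (real^'n) set" where
  "feasible_set A b = {x. A *v x \<ge> b}"

definition global_minimizer :: "('a \<Rightarrow> real) \<Rightarrow> 'a set \<Rightarrow> 'a \<Rightarrow> bool" where
  "global_minimizer f C x \<longleftrightarrow> x \<in> C \<and> (\<forall>y\<in>C. f x \<le> f y)"

(* Real eigenvalues only; for the symmetric matrices considered here these are all
   eigenvalues. *)
definition eigenvalues :: "real^'n^'n \<Rightarrow> real set" where
  "eigenvalues Q = {l. \<exists>v. v \<noteq> 0 \<and> Q *v v = l *\<^sub>R v}"

(* The metric projection onto C is the library's closest_point C.  The derivative is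
   one-sided at t = 0.  For closed convex nonempty C the right-hand side is continuous,
   so every solution is automatically continuously differentiable on [0, infinity). *)
definition projection_flow ::
  "real^'n^'n \<Rightarrow> real^'n \<Rightarrow> (real^'n) set \<Rightarrow> real \<Rightarrow> real \<Rightarrow> real^'n \<Rightarrow> (real \<Rightarrow> real^'n) \<Rightarrow> bool" where
  "projection_flow Q q C \<rho> \<eta> x0 x \<longleftrightarrow>
     x 0 = x0 \<and>
     (\<forall>t\<ge>0. (x has_vector_derivative
        (1 / \<eta>) *\<^sub>R (closest_point C (x t - (1 / \<rho>) *\<^sub>R (Q *v x t + q)) - x t))
        (at t within {0..}))"

(* For symmetric Q the set of eigenvalues is finite and nonempty, so Max is the
   genuine maximum. *)
definition decay_rate :: "real^'n^'n \<Rightarrow> real \<Rightarrow> real" where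
  "decay_rate Q \<rho> = Max ((\<lambda>l. (l / \<rho>) * (l / (4 * \<rho>) - 1)) ` eigenvalues Q)"

end

theory Submission
  imports Defs
begin

text \<open>
  Write \<open>d = x(t) - x*\<close> and let \<open>p\<close> be the bracket on the right-hand side of the flow, so that
  half the derivative of \<open>|d|^2\<close> is \<open>(p \<bullet> d) / \<eta>\<close>. The theorem is the Gronwall estimate
  (\<open>norm_growth_from_inner_bound\<close>) that belongs to \<open>p \<bullet> d \<le> \<alpha> |d|^2\<close> with \<open>\<alpha> = decay_rate Q \<rho>\<close>, and this inequality
  is where the geometry enters (\<open>projection_step_inner_le\<close>).

  The projected point \<open>p + x(t)\<close> and the minimizer \<open>x*\<close> both lie in the convex set \<open>C\<close>. Testing the
  obtuse-angle property of the projection with \<open>x*\<close>, and the first-order optimality of \<open>x*\<close> with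
  the projected point, gives \<open>(p + Qd/\<rho>) \<bullet> (p + d) \<le> 0\<close>. Completing the square in \<open>p\<close> turns
  this into \<open>p \<bullet> d \<le> |Bd|^2 - |d|^2\<close> with \<open>B = Q/(2\<rho>) - I\<close>.

  Each eigenvalue \<open>\<lambda>\<close> of \<open>Q\<close> satisfies
  \<open>(\<lambda>/\<rho>) (\<lambda>/(4\<rho>) - 1) = (\<lambda>/(2\<rho>) - 1)^2 - 1\<close>, so \<open>\<alpha> + 1\<close> is the largest square of
  an eigenvalue of \<open>B\<close>. As \<open>B\<close> is symmetric, that is the square of its operator norm
  (\<open>symmetric_norm_bounded_by_eigenvalue\<close>).
\<close>

section \<open>Symmetric maps and the decay rate\<close>

text \<open>
  A unit vector \<open>v\<close> maximizing \<open>|Bv|\<close>, with maximum \<open>s\<close>, satisfies \<open>B(Bv) = s^2 v\<close>, because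
  \<open>|B(Bv) - s^2 v|^2 = |B(Bv)|^2 - 2 s^2 |Bv|^2 + s^4 \<le> 0\<close>, where
  \<open>|Bv| = s\<close> and, by maximality, \<open>|B(Bv)| \<le> s |Bv|\<close>. Thus \<open>(B - s)(B + s) v = 0\<close>, and
  either \<open>v\<close> is an eigenvector for \<open>-s\<close> or \<open>(B + s) v\<close> is one for \<open>s\<close>.
\<close>

lemma symmetric_norm_bounded_by_eigenvalue:
  fixes B :: "'a::euclidean_space \<Rightarrow> 'a"
  assumes lin: "linear B" and sym: "\<And>u v. B u \<bullet> v = u \<bullet> B v"
  obtains c v where "v \<noteq> 0" "B v = c *\<^sub>R v" "\<And>d. norm (B d) \<le> \<bar>c\<bar> * norm d"
proof -
  obtain e :: 'a where e: "norm e = 1"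
    using vector_choose_size[of 1] by auto
  have "continuous_on (sphere 0 1) (\<lambda>v. norm (B v))"
    by (intro continuous_on_norm linear_continuous_on linear_conv_bounded_linear[THEN iffD1] lin)
  moreover have "sphere (0::'a) 1 \<noteq> {}"
    using e by auto
  ultimately obtain v where v: "norm v = 1"
    and max: "\<And>w. norm w = 1 \<Longrightarrow> norm (B w) \<le> norm (B v)"
    using continuous_attains_sup[of "sphere (0::'a) 1" "\<lambda>v. norm (B v)"] by auto
  define s where "s = norm (B v)"
  have bound: "norm (B d) \<le> s * norm d" for d
  proof (cases "d = 0")
    case True
    then show ?thesis
      using lin by (simp add: linear_0)
  next
    case False
    have "norm (B (d /\<^sub>R norm d)) \<le> s"
      unfolding s_def by (rule max) (use False in simp)
    then show ?thesis
      using False lin by (simp add: linear_cmul divide_simps mult.commute)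
  qed
  have s2: "B (B v) \<bullet> v = s\<^sup>2"
    by (simp add: sym s_def power2_norm_eq_inner)
  have "(norm (B (B v)))\<^sup>2 \<le> (s * s)\<^sup>2"
    using bound[of "B v"] by (intro power_mono) (auto simp: s_def)
  moreover have "(norm (B (B v) - s\<^sup>2 *\<^sub>R v))\<^sup>2
      = (norm (B (B v)))\<^sup>2 - 2 * s\<^sup>2 * (B (B v) \<bullet> v) + (s * s)\<^sup>2 * (norm v)\<^sup>2"
    unfolding power2_norm_eq_inner
    by (simp add: inner_diff inner_commute power2_eq_square algebra_simps)
  ultimately have "(norm (B (B v) - s\<^sup>2 *\<^sub>R v))\<^sup>2 \<le> 0"
    using v unfolding s2 by (simp add: power2_eq_square)
  then have BB: "B (B v) = s\<^sup>2 *\<^sub>R v"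
    by simp
  show thesis
  proof (cases "B v + s *\<^sub>R v = 0")
    case True
    show thesis
    proof (rule that)
      show "v \<noteq> 0" using v by auto
      show "B v = (-s) *\<^sub>R v" using True by (simp add: eq_neg_iff_add_eq_0)
      show "norm (B d) \<le> \<bar>-s\<bar> * norm d" for d
        using bound[of d] by (simp add: s_def)
    qed
  next
    case False
    show thesis
    proof (rule that)
      show "B (B v + s *\<^sub>R v) = s *\<^sub>R (B v + s *\<^sub>R v)"
        using lin by (simp add: linear_add linear_cmul BB algebra_simps power2_eq_square)
      show "norm (B d) \<le> \<bar>s\<bar> * norm d" for d
        using bound[of d] by (simp add: s_def)
    qed (fact False)
  qed
qed

lemma symmetric_matrix_inner:
  fixes Q :: "real^'n^'n"
  assumes "transpose Q = Q"
  shows "(Q *v u) \<bullet> v = u \<bullet> (Q *v v)"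
  by (metis assms dot_lmul_matrix transpose_matrix_vector)

text \<open>
  Finiteness is what makes the \<open>Max\<close> in \<open>decay_rate\<close> an upper bound. It holds because
  eigenvectors for distinct eigenvalues are orthogonal.
\<close>

lemma finite_eigenvalues_symmetric:
  fixes Q :: "real^'n^'n"
  assumes sym: "transpose Q = Q"
  shows "finite (eigenvalues Q)"
proof -
  define v where "v = (\<lambda>l. SOME v. v \<noteq> 0 \<and> Q *v v = l *\<^sub>R v)"
  have v: "v l \<noteq> 0 \<and> Q *v v l = l *\<^sub>R v l" if "l \<in> eigenvalues Q" for l
    using that unfolding v_def eigenvalues_def mem_Collect_eq by (rule someI_ex)
  have orth: "orthogonal (v k) (v l)"
    if "k \<in> eigenvalues Q" "l \<in> eigenvalues Q" "k \<noteq> l" for k l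
  proof -
    have "k * (v k \<bullet> v l) = l * (v k \<bullet> v l)"
      using symmetric_matrix_inner[OF sym, of "v k" "v l"] v that by simp
    then show ?thesis
      using that by (simp add: orthogonal_def)
  qed
  have "inj_on v (eigenvalues Q)"
  proof (rule inj_onI, rule ccontr)
    fix k l
    assume "k \<in> eigenvalues Q" "l \<in> eigenvalues Q" "v k = v l" "k \<noteq> l"
    then show False
      using orth[of k l] v[of l] by (simp add: orthogonal_self)
  qed
  moreover have "finite (v ` eigenvalues Q)"
    using orth by (intro pairwise_orthogonal_imp_finite) (auto simp: pairwise_def)
  ultimately show ?thesis
    using finite_imageD by blast
qed

text \<open>
  The operator \<open>B = Q/(2\<rho>) - I\<close> attains its norm at an eigenvalue \<open>c\<close>, which comes from the
  eigenvalue \<open>2\<rho>(c + 1)\<close> of \<open>Q\<close>; that eigenvalue contributes exactly \<open>c^2 - 1\<close> to the maximum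
  defining \<open>decay_rate\<close>.
\<close>

lemma norm_shifted_le_decay_rate:
  fixes Q :: "real^'n^'n"
  assumes sym: "transpose Q = Q" and \<rho>: "\<rho> > 0"
  shows "(norm ((1 / (2 * \<rho>)) *\<^sub>R (Q *v d) - d))\<^sup>2 \<le> (decay_rate Q \<rho> + 1) * (norm d)\<^sup>2"
proof -
  define B where "B = (\<lambda>d. (1 / (2 * \<rho>)) *\<^sub>R (Q *v d) - d)"
  have lin: "linear B"
    unfolding B_def by (rule linearI) (simp_all add: algebra_simps)
  have Bsym: "B u \<bullet> w = u \<bullet> B w" for u w
    using symmetric_matrix_inner[OF sym, of u w]
    by (simp add: B_def inner_diff)
  obtain c v where v: "v \<noteq> 0" "B v = c *\<^sub>R v"
    and bound: "\<And>d. norm (B d) \<le> \<bar>c\<bar> * norm d"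
    using symmetric_norm_bounded_by_eigenvalue[OF lin Bsym] by metis
  define l where "l = 2 * \<rho> * (c + 1)"
  have "(1 / (2 * \<rho>)) *\<^sub>R (Q *v v) = (c + 1) *\<^sub>R v"
    using v(2) by (simp add: B_def algebra_simps)
  then have "(2 * \<rho>) *\<^sub>R (1 / (2 * \<rho>)) *\<^sub>R (Q *v v) = (2 * \<rho>) *\<^sub>R (c + 1) *\<^sub>R v"
    by simp
  then have "Q *v v = l *\<^sub>R v"
    using \<rho> by (simp add: l_def)
  then have "l \<in> eigenvalues Q"
    using v(1) by (auto simp: eigenvalues_def)
  then have "(l / \<rho>) * (l / (4 * \<rho>) - 1) \<le> decay_rate Q \<rho>"
    unfolding decay_rate_def
    by (intro Max_ge finite_imageI finite_eigenvalues_symmetric sym) auto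
  moreover have "(l / \<rho>) * (l / (4 * \<rho>) - 1) = c\<^sup>2 - 1"
    using \<rho> by (simp add: l_def field_simps power2_eq_square)
  ultimately have c: "c\<^sup>2 \<le> decay_rate Q \<rho> + 1"
    by simp
  have "(norm (B d))\<^sup>2 \<le> (\<bar>c\<bar> * norm d)\<^sup>2"
    by (intro power_mono bound) auto
  also have "\<dots> = c\<^sup>2 * (norm d)\<^sup>2"
    by (simp add: power_mult_distrib)
  also have "\<dots> \<le> (decay_rate Q \<rho> + 1) * (norm d)\<^sup>2"
    by (intro mult_right_mono c) simp
  finally show ?thesis
    by (simp add: B_def)
qed

section \<open>Optimality and the projection step\<close>

text \<open>
  Moving from the minimizer a fraction \<open>s\<close> of the way towards \<open>z\<close> changes the objective by
  \<open>s\<close> times an affine function of \<open>s\<close>, which is therefore nonnegative on \<open>(0,1)\<close>; its limit at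
  \<open>0\<close> is the directional derivative.
\<close>

lemma quadratic_minimizer_variational_inequality:
  fixes Q :: "real^'n^'n"
  assumes sym: "transpose Q = Q" and "convex C"
    and min: "global_minimizer (quad_objective Q q) C xs" and z: "z \<in> C"
  shows "0 \<le> (Q *v xs + q) \<bullet> (z - xs)"
proof -
  define h where "h = z - xs"
  have expand: "quad_objective Q q (xs + s *\<^sub>R h) - quad_objective Q q xs
      = s * ((Q *v xs + q) \<bullet> h + s * (h \<bullet> (Q *v h) / 2))" for s
    using symmetric_matrix_inner[OF sym, of xs h]
    by (simp add: quad_objective_def algebra_simps inner_commute)
  have ge: "0 \<le> (Q *v xs + q) \<bullet> h + s * (h \<bullet> (Q *v h) / 2)" if "0 < s" "s < 1" for s
  proof -
    have "(1 - s) *\<^sub>R xs + s *\<^sub>R z \<in> C"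
      using assms that by (intro convexD_alt) (auto simp: global_minimizer_def)
    then have "xs + s *\<^sub>R h \<in> C"
      by (simp add: h_def algebra_simps)
    then have "0 \<le> quad_objective Q q (xs + s *\<^sub>R h) - quad_objective Q q xs"
      using min by (simp add: global_minimizer_def)
    then show ?thesis
      using that unfolding expand by (simp add: zero_le_mult_iff)
  qed
  have "((\<lambda>s. (Q *v xs + q) \<bullet> h + s * (h \<bullet> (Q *v h) / 2)) \<longlongrightarrow>
      (Q *v xs + q) \<bullet> h + 0 * (h \<bullet> (Q *v h) / 2)) (at_right 0)"
    by (intro tendsto_intros)
  moreover have "eventually (\<lambda>s. 0 \<le> (Q *v xs + q) \<bullet> h + s * (h \<bullet> (Q *v h) / 2)) (at_right 0)"
    using ge by (intro eventually_at_rightI[of 0 1]) auto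
  ultimately have "0 \<le> (Q *v xs + q) \<bullet> h + 0 * (h \<bullet> (Q *v h) / 2)"
    by (rule tendsto_lowerbound) simp
  then show ?thesis
    by (simp add: h_def)
qed

text \<open>
  The common \<open>q\<close> cancels when the variational inequality is subtracted from the projection
  inequality, leaving \<open>(p + 2r) \<bullet> (p + d) \<le> 0\<close> with \<open>r = Qd/(2\<rho>)\<close>. The terms in \<open>p\<close> other
  than \<open>p \<bullet> d\<close> are absorbed in \<open>|p + r|^2 \<ge> 0\<close>, and \<open>r - d\<close> is the vector bounded by
  \<open>norm_shifted_le_decay_rate\<close>.
\<close>

lemma projection_step_inner_le:
  fixes Q :: "real^'n^'n"
  assumes sym: "transpose Q = Q" and "\<rho> > 0" and C: "convex C" "closed C"
    and min: "global_minimizer (quad_objective Q q) C xs"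
  shows "(closest_point C (y - (1 / \<rho>) *\<^sub>R (Q *v y + q)) - y) \<bullet> (y - xs)
    \<le> decay_rate Q \<rho> * (norm (y - xs))\<^sup>2"
proof -
  define w where "w = y - (1 / \<rho>) *\<^sub>R (Q *v y + q)"
  define p where "p = closest_point C w - y"
  define d where "d = y - xs"
  define r where "r = (1 / (2 * \<rho>)) *\<^sub>R (Q *v d)"
  have xs: "xs \<in> C"
    using min by (simp add: global_minimizer_def)
  have proj: "(w - closest_point C w) \<bullet> (xs - closest_point C w) \<le> 0"
    using C xs by (rule closest_point_dot)
  have "closest_point C w \<in> C"
    using C xs by (intro closest_point_in_set) auto
  then have "0 \<le> (Q *v xs + q) \<bullet> (closest_point C w - xs)"
    by (rule quadratic_minimizer_variational_inequality[OF sym C(1) min])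
  then have vi: "0 \<le> ((1 / \<rho>) *\<^sub>R (Q *v xs + q)) \<bullet> (p + d)"
    using \<open>\<rho> > 0\<close> by (simp add: p_def d_def)
  have r2: "2 *\<^sub>R r = (1 / \<rho>) *\<^sub>R (Q *v y + q) - (1 / \<rho>) *\<^sub>R (Q *v xs + q)"
    by (simp add: r_def d_def algebra_simps)
  have "(p + (1 / \<rho>) *\<^sub>R (Q *v y + q)) \<bullet> (p + d) \<le> 0"
    using proj by (simp add: p_def d_def w_def inner_diff inner_add algebra_simps inner_commute)
  with vi have "(p + 2 *\<^sub>R r) \<bullet> (p + d) \<le> 0"
    unfolding r2 by (simp add: inner_diff inner_add)
  moreover have "p \<bullet> d = - (norm (p + r))\<^sup>2 + (p + 2 *\<^sub>R r) \<bullet> (p + d) + (norm (r - d))\<^sup>2 - (norm d)\<^sup>2"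
    by (simp add: power2_norm_eq_inner inner_diff inner_add algebra_simps inner_commute)
  moreover have "0 \<le> (norm (p + r))\<^sup>2"
    by simp
  moreover have "(norm (r - d))\<^sup>2 \<le> (decay_rate Q \<rho> + 1) * (norm d)\<^sup>2"
    unfolding r_def by (rule norm_shifted_le_decay_rate[OF sym \<open>\<rho> > 0\<close>])
  moreover have "(decay_rate Q \<rho> + 1) * (norm d)\<^sup>2 = decay_rate Q \<rho> * (norm d)\<^sup>2 + (norm d)\<^sup>2"
    by (simp add: algebra_simps)
  ultimately have "p \<bullet> d \<le> decay_rate Q \<rho> * (norm d)\<^sup>2"
    by linarith
  then show ?thesis
    by (simp add: p_def d_def w_def)
qed

section \<open>From the differential inequality to the exponential bound\<close>

text \<open>
  Gronwall's argument: the bound says that \<open>exp (-2at) |d(t)|^2\<close> has nonpositive derivative.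
  Working with the squared norm keeps everything differentiable where \<open>d\<close> vanishes.
\<close>

lemma norm_growth_from_inner_bound:
  fixes d d' :: "real \<Rightarrow> 'a::real_inner"
  assumes deriv: "\<And>t. t \<ge> 0 \<Longrightarrow> (d has_vector_derivative d' t) (at t within {0..})"
    and bound: "\<And>t. t \<ge> 0 \<Longrightarrow> d' t \<bullet> d t \<le> a * (norm (d t))\<^sup>2"
    and "t \<ge> 0"
  shows "norm (d t) \<le> exp (a * t) * norm (d 0)"
proof -
  define E where "E = (\<lambda>s. exp (- 2 * a * s) * (d s \<bullet> d s))"
  define E' where "E' = (\<lambda>s. 2 * exp (- 2 * a * s) * (d' s \<bullet> d s - a * (norm (d s))\<^sup>2))"
  have E: "(E has_real_derivative E' s) (at s within {0..})" if "s \<ge> 0" for s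
  proof -
    have "((\<lambda>s. d s \<bullet> d s) has_real_derivative 2 * (d' s \<bullet> d s)) (at s within {0..})"
      using bounded_bilinear.has_vector_derivative[OF bounded_bilinear_inner
          deriv[OF that] deriv[OF that]]
      by (simp add: has_real_derivative_iff_has_vector_derivative inner_commute)
    then show ?thesis
      unfolding E_def E'_def
      by (auto intro!: derivative_eq_intros simp: power2_norm_eq_inner algebra_simps)
  qed
  have "E t \<le> E 0"
  proof (rule DERIV_nonpos_imp_decreasing_open[OF \<open>t \<ge> 0\<close>])
    fix s :: real
    assume "0 < s" "s < t"
    then have "at s within {0..} = at s"
      by (intro at_within_interior) auto
    then have "DERIV E s :> E' s"
      using E[of s] \<open>0 < s\<close> by simp
    moreover have "E' s \<le> 0"
      using bound[of s] \<open>0 < s\<close> by (simp add: E'_def mult_le_0_iff)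
    ultimately show "\<exists>y. DERIV E s :> y \<and> y \<le> 0"
      by blast
  next
    have "continuous_on {0..} E"
      using E by (intro DERIV_continuous_on) auto
    then show "continuous_on {0..t} E"
      by (rule continuous_on_subset) auto
  qed
  then have "exp (2 * a * t) * E t \<le> exp (2 * a * t) * E 0"
    by simp
  moreover have "exp (2 * a * t) * E t = (norm (d t))\<^sup>2"
    by (simp add: E_def power2_norm_eq_inner flip: mult.assoc exp_add)
  moreover have "exp (2 * a * t) * E 0 = (exp (a * t) * norm (d 0))\<^sup>2"
    using exp_double[of "a * t"]
    by (simp add: E_def power2_norm_eq_inner power_mult_distrib mult.assoc)
  ultimately show ?thesis
    by (auto intro: power2_le_imp_le)
qed

lemma closed_convex_feasible_set:
  shows "closed (feasible_set A b)" and "convex (feasible_set A b)"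
proof -
  have eq: "feasible_set A b = (\<Inter>i. {x. row i A \<bullet> x \<ge> b $ i})"
    by (auto simp: feasible_set_def less_eq_vec_def matrix_vector_mult_def row_def inner_vec_def)
  show "closed (feasible_set A b)" "convex (feasible_set A b)"
    unfolding eq by (intro closed_INT ballI closed_halfspace_ge convex_INT convex_halfspace_ge)+
qed

theorem theorem8:
  fixes Q :: "real^'n^'n" and A :: "real^'n^'m"
    and q :: "real^'n" and b :: "real^'m"
    and \<eta> \<rho> :: real
    and x0 xstar :: "real^'n" and x :: "real \<Rightarrow> real^'n"
  assumes "transpose Q = Q"
    and "feasible_set A b \<noteq> {}"
    and "\<eta> > 0" and "\<rho> > 0"
    and "bdd_below (quad_objective Q q ` feasible_set A b)"
    and "global_minimizer (quad_objective Q q) (feasible_set A b) xstar"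
    and "x0 \<in> feasible_set A b"
    and "projection_flow Q q (feasible_set A b) \<rho> \<eta> x0 x"
  shows "\<forall>t\<ge>0. norm (x t - xstar) \<le> exp (decay_rate Q \<rho> / \<eta> * t) * norm (x0 - xstar)"
proof (intro allI impI)
  fix t :: real
  assume "t \<ge> 0"
  define p where "p = (\<lambda>s. closest_point (feasible_set A b)
    (x s - (1 / \<rho>) *\<^sub>R (Q *v x s + q)) - x s)"
  have x: "x 0 = x0"
    "\<And>s. s \<ge> 0 \<Longrightarrow> (x has_vector_derivative (1 / \<eta>) *\<^sub>R p s) (at s within {0..})"
    using assms(8) by (auto simp: projection_flow_def p_def)
  have "norm (x t - xstar) \<le> exp (decay_rate Q \<rho> / \<eta> * t) * norm (x 0 - xstar)"
  proof (rule norm_growth_from_inner_bound[OF _ _ \<open>t \<ge> 0\<close>])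
    fix s :: real
    assume s: "s \<ge> 0"
    show "((\<lambda>s. x s - xstar) has_vector_derivative (1 / \<eta>) *\<^sub>R p s) (at s within {0..})"
      using x(2)[OF s] by (auto intro!: derivative_eq_intros)
    have "p s \<bullet> (x s - xstar) \<le> decay_rate Q \<rho> * (norm (x s - xstar))\<^sup>2"
      unfolding p_def
      by (rule projection_step_inner_le[OF assms(1,4) closed_convex_feasible_set(2,1) assms(6)])
    then show "(1 / \<eta>) *\<^sub>R p s \<bullet> (x s - xstar)
        \<le> decay_rate Q \<rho> / \<eta> * (norm (x s - xstar))\<^sup>2"
      using \<open>\<eta> > 0\<close> by (simp add: divide_right_mono)
  qed
  then show "norm (x t - xstar) \<le> exp (decay_rate Q \<rho> / \<eta> * t) * norm (x0 - xstar)"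
    by (simp add: x(1))
qed

end
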